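(* Let $X$ be a complex Banach space and let $\mathcal{A}$ be a norm-closed subalgebra of $B(X)$ such that $\vee\{x: x\otimes f\in\mathcal{A}\}=X$ and $\wedge\{\ker(f): x\otimes f\in\mathcal{A}\}=(0)$. Then every Jordan higher derivation on $\mathcal{A}$ is bounded.
   Context: $B(X)$ is the algebra of all bounded linear operators on $X$. For non-zero $x\in X$ and $f\in X^*$, $x\otimes f$ is the rank one operator $y\mapsto f(y)x$; in the displayed conditions $x$ and $f$ range over non-zero vectors of $X$ and $X^*$ with $x\otimes f\in\mathcal{A}$. The symbol $\vee$ denotes closed linear span and $\wedge$ denotes intersection. Let $\mathbb{N}$ be the set of non-negative integers. A sequence $\{d_i\}_{i\in\mathbb{N}}$ of linear mappings from $\mathcal{A}$ to $\mathcal{A}$ with $d_0$ the identity mapping is a Jordan higher derivation on $\mathcal{A}$ if $d_n(AB+BA)=\sum_{i+j=n}(d_i(A)d_j(B)+d_i(B)d_j(A))$ for all $n\in\mathbb{N}$ and all $A,B\in\mathcal{A}$. It is bounded if every $d_n$ is a bounded linear mapping. *)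

theory Defs
  imports "HOL-Analysis.Bounded_Linear_Function"
begin

section \<open>Complex normed spaces\<close>

class scaleC = scaleR +
  fixes scaleC :: "complex \<Rightarrow> 'a \<Rightarrow> 'a" (infixr "*\<^sub>C" 75)
  assumes scaleR_scaleC: "r *\<^sub>R x = complex_of_real r *\<^sub>C x"

class complex_vector = scaleC + real_vector +
  assumes scaleC_add_right: "a *\<^sub>C (x + y) = a *\<^sub>C x + a *\<^sub>C y"
    and scaleC_add_left: "(a + b) *\<^sub>C x = a *\<^sub>C x + b *\<^sub>C x"
    and scaleC_scaleC: "a *\<^sub>C b *\<^sub>C x = (a * b) *\<^sub>C x"
    and scaleC_one: "1 *\<^sub>C x = x"

class complex_normed_vector = complex_vector + real_normed_vector +
  assumes norm_scaleC: "norm (a *\<^sub>C x) = cmod a * norm x"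

class complex_banach = complex_normed_vector + banach

global_interpretation complex_vector:
  vector_space "scaleC :: complex \<Rightarrow> 'a \<Rightarrow> 'a::complex_vector"
  defines csubspace = complex_vector.subspace
    and cspan = complex_vector.span
  by unfold_locales (simp_all add: scaleC_add_right scaleC_add_left scaleC_scaleC scaleC_one)

abbreviation clinear :: "('a::complex_vector \<Rightarrow> 'b::complex_vector) \<Rightarrow> bool"
  where "clinear \<equiv> Vector_Spaces.linear (*\<^sub>C) (*\<^sub>C)"

lemma bounded_linear_scaleC: "bounded_linear ((*\<^sub>C) c :: 'a::complex_normed_vector \<Rightarrow> 'a)"
proof (rule bounded_linear_intro)
  fix r and x y :: 'a
  show "c *\<^sub>C (x + y) = c *\<^sub>C x + c *\<^sub>C y"
    by (rule scaleC_add_right)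
  show "c *\<^sub>C (r *\<^sub>R x) = r *\<^sub>R (c *\<^sub>C x)"
    by (simp add: scaleR_scaleC scaleC_scaleC mult.commute)
  show "norm (c *\<^sub>C x) \<le> norm x * cmod c"
    by (simp add: norm_scaleC mult.commute)
qed

lemma bounded_linear_scaleC_left:
  "bounded_linear (\<lambda>c. c *\<^sub>C x)" for x :: "'a::complex_normed_vector"
proof (rule bounded_linear_intro)
  fix r :: real and a b :: complex
  show "(a + b) *\<^sub>C x = a *\<^sub>C x + b *\<^sub>C x"
    by (rule scaleC_add_left)
  show "(r *\<^sub>R a) *\<^sub>C x = r *\<^sub>R (a *\<^sub>C x)"
    by (simp add: scaleR_scaleC scaleC_scaleC scaleR_conv_of_real)
  show "norm (a *\<^sub>C x) \<le> norm a * norm x"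
    by (simp add: norm_scaleC)
qed

instantiation complex :: complex_banach
begin

definition scaleC_complex :: "complex \<Rightarrow> complex \<Rightarrow> complex"
  where "scaleC_complex = (*)"

instance
  by standard (simp_all add: scaleC_complex_def scaleR_conv_of_real algebra_simps norm_mult)

end

instantiation blinfun :: (real_normed_vector, complex_normed_vector) complex_normed_vector
begin

lift_definition scaleC_blinfun :: "complex \<Rightarrow> 'a \<Rightarrow>\<^sub>L 'b \<Rightarrow> 'a \<Rightarrow>\<^sub>L 'b"
  is "\<lambda>c T x. c *\<^sub>C T x"
  by (rule bounded_linear_compose[OF bounded_linear_scaleC])

instance
proof
  fix a b :: complex and r :: real and S T :: "'a \<Rightarrow>\<^sub>L 'b"
  show "r *\<^sub>R T = complex_of_real r *\<^sub>C T"
    by transfer (simp add: scaleR_scaleC)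
  show "a *\<^sub>C (S + T) = a *\<^sub>C S + a *\<^sub>C T"
    by transfer (simp add: scaleC_add_right)
  show "(a + b) *\<^sub>C T = a *\<^sub>C T + b *\<^sub>C T"
    by transfer (simp add: scaleC_add_left)
  show "a *\<^sub>C b *\<^sub>C T = (a * b) *\<^sub>C T"
    by transfer (simp add: scaleC_scaleC)
  show "1 *\<^sub>C T = T"
    by transfer (simp add: scaleC_one)
  show "norm (a *\<^sub>C T) = cmod a * norm T"
  proof transfer
    fix a :: complex and T :: "'a \<Rightarrow> 'b"
    have "onorm (\<lambda>x. a *\<^sub>C T x) = onorm (\<lambda>x. cmod a *\<^sub>R T x)"
      by (simp add: onorm_def norm_scaleC)
    moreover assume "bounded_linear T"
    ultimately show "onorm (\<lambda>x. a *\<^sub>C T x) = cmod a * onorm T"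
      by (simp add: onorm_scaleR)
  qed
qed

end

section \<open>Operators and algebras of operators\<close>

text \<open>The type of bounded linear functions consists of the real-linear ones, so the complex-linear
  ones are singled out. The norm is the usual operator norm.\<close>

definition bounded_operators :: "('a::complex_normed_vector \<Rightarrow>\<^sub>L 'a) set"
  where "bounded_operators = {T. clinear (blinfun_apply T)}"

definition dual_space :: "('a::complex_normed_vector \<Rightarrow>\<^sub>L complex) set"
  where "dual_space = {f. clinear (blinfun_apply f)}"

lift_definition rank_one ::
  "'a::complex_normed_vector \<Rightarrow> ('a \<Rightarrow>\<^sub>L complex) \<Rightarrow> 'a \<Rightarrow>\<^sub>L 'a" (infix "\<otimes>\<^sub>1" 70)
  is "\<lambda>x f y. f y *\<^sub>C x"
  by (rule bounded_linear_compose[OF bounded_linear_scaleC_left])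

text \<open>Subalgebras need not contain the identity operator.\<close>

definition operator_subalgebra :: "('a::complex_normed_vector \<Rightarrow>\<^sub>L 'a) set \<Rightarrow> bool"
  where "operator_subalgebra \<A> \<longleftrightarrow>
    \<A> \<subseteq> bounded_operators \<and> csubspace \<A> \<and> (\<forall>S\<in>\<A>. \<forall>T\<in>\<A>. S o\<^sub>L T \<in> \<A>)"

definition rank_one_pairs ::
  "('a::complex_normed_vector \<Rightarrow>\<^sub>L 'a) set \<Rightarrow> ('a \<times> ('a \<Rightarrow>\<^sub>L complex)) set"
  where "rank_one_pairs \<A> =
    {(x, f). x \<noteq> 0 \<and> f \<in> dual_space \<and> f \<noteq> 0 \<and> x \<otimes>\<^sub>1 f \<in> \<A>}"

section \<open>Jordan higher derivations\<close>

definition linear_mapping_on ::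
  "'b::complex_vector set \<Rightarrow> ('b \<Rightarrow> 'b) \<Rightarrow> bool"
  where "linear_mapping_on \<A> \<delta> \<longleftrightarrow>
    (\<forall>A\<in>\<A>. \<delta> A \<in> \<A>) \<and>
    (\<forall>A\<in>\<A>. \<forall>B\<in>\<A>. \<delta> (A + B) = \<delta> A + \<delta> B) \<and>
    (\<forall>c. \<forall>A\<in>\<A>. \<delta> (c *\<^sub>C A) = c *\<^sub>C \<delta> A)"

definition jordan_higher_derivation ::
  "('a::complex_normed_vector \<Rightarrow>\<^sub>L 'a) set \<Rightarrow> (nat \<Rightarrow> ('a \<Rightarrow>\<^sub>L 'a) \<Rightarrow> ('a \<Rightarrow>\<^sub>L 'a)) \<Rightarrow> bool"
  where "jordan_higher_derivation \<A> d \<longleftrightarrow>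
    (\<forall>n. linear_mapping_on \<A> (d n)) \<and>
    (\<forall>A\<in>\<A>. d 0 A = A) \<and>
    (\<forall>n. \<forall>A\<in>\<A>. \<forall>B\<in>\<A>.
      d n ((A o\<^sub>L B) + (B o\<^sub>L A)) =
        (\<Sum>(i, j) \<in> {(i, j). i + j = n}. (d i A o\<^sub>L d j B) + (d i B o\<^sub>L d j A)))"

text \<open>The index set of the sum above is finite, so the sum is not zero by convention.\<close>

lemma sum_add_eq_conv_atMost:
  fixes g :: "nat \<Rightarrow> nat \<Rightarrow> 'b::comm_monoid_add"
  shows "(\<Sum>(i, j) \<in> {(i, j). i + j = n}. g i j) = (\<Sum>i\<le>n. g i (n - i))"
  by (rule sum.reindex_bij_witness[where i = "\<lambda>i. (i, n - i)" and j = fst]) auto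

definition bounded_on :: "'b::real_normed_vector set \<Rightarrow> ('b \<Rightarrow> 'b) \<Rightarrow> bool"
  where "bounded_on \<A> \<delta> \<longleftrightarrow> (\<exists>K. \<forall>A\<in>\<A>. norm (\<delta> A) \<le> K * norm A)"

definition bounded_sequence_on ::
  "'b::real_normed_vector set \<Rightarrow> (nat \<Rightarrow> 'b \<Rightarrow> 'b) \<Rightarrow> bool"
  where "bounded_sequence_on \<A> d \<longleftrightarrow> (\<forall>n. bounded_on \<A> (d n))"

end

theory Submission
  imports Defs "HOL-Analysis.Urysohn"
begin

text \<open>By induction on \<open>n\<close>, assume that \<open>d i\<close> is bounded for \<open>i < n\<close>. By the closed graph
  theorem it suffices that \<open>T = 0\<close> whenever \<open>u k \<longlonglongrightarrow> 0\<close> and \<open>d n (u k) \<longlonglongrightarrow> T\<close>. The lower order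
  terms of the Jordan identity vanish in the limit, so \<open>d n (u k \<circ> B) \<longlonglongrightarrow> T \<circ> B\<close> for the Jordan
  product \<open>\<circ>\<close>. As \<open>B A C + C A B\<close> is built from Jordan products, also
  \<open>d n (B (u k) C + C (u k) B) \<longlonglongrightarrow> B T C + C T B\<close>. For rank one \<open>B\<close> and \<open>C\<close> in the algebra the
  arguments on the left are scalar multiples, with scalars tending to \<open>0\<close>, of fixed elements
  of the algebra, so \<open>B T C + C T B = 0\<close>. This forces \<open>f (T y) = 0\<close> for all vectors \<open>y\<close> and
  functionals \<open>f\<close> occurring in rank one elements, and hence \<open>T = 0\<close>.\<close>

section \<open>The closed graph theorem\<close>

text \<open>Baire's theorem is applied in the subspace topology of \<open>S\<close>, which is
  completely metrizable because \<open>S\<close> is closed: the operators in question form only a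
  closed subset of their type.\<close>

lemma closed_subspace_Baire:
  fixes S :: "'a::banach set" and V :: "nat \<Rightarrow> 'a set"
  assumes "closed S" "S \<noteq> {}" and cover: "S \<subseteq> (\<Union>m. V m)"
  obtains m a r where "a \<in> S" "r > 0" "ball a r \<inter> S \<subseteq> closure (V m)"
proof -
  let ?X = "top_of_set S"
  let ?G = "range (\<lambda>m. S \<inter> closure (V m))"
  have "completely_metrizable_space ?X"
    using completely_metrizable_space_closedin completely_metrizable_space_euclidean assms(1)
    by (metis closed_closedin)
  moreover have "?X interior_of \<Union>?G \<noteq> {}"
  proof -
    have "x \<in> \<Union>?G" if x: "x \<in> S" for x
    proof -
      obtain m where "x \<in> V m"
        using x cover by auto
      then have "x \<in> closure (V m)"
        using closure_subset by (rule rev_subsetD)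
      then show ?thesis
        using x by auto
    qed
    then have "\<Union>?G = topspace ?X"
      by auto
    then show ?thesis
      using assms(2) by (metis interior_of_topspace topspace_euclidean_subtopology)
  qed
  moreover have "countable ?G"
    by simp
  ultimately obtain T where T: "T \<in> ?G" "\<not> (closedin ?X T \<and> ?X interior_of T = {})"
    using Baire_category_alt[of ?X ?G] by metis
  then obtain m where m: "T = S \<inter> closure (V m)"
    by blast
  then have "closedin ?X T"
    by (simp add: closedin_closed_Int)
  with T(2) obtain a U where U: "openin ?X U" "a \<in> U" "U \<subseteq> T"
    by (auto simp: interior_of_def)
  then obtain r where "r > 0" "ball a r \<inter> S \<subseteq> U"
    by (auto simp: openin_contains_ball)
  moreover have "U \<subseteq> closure (V m)" "a \<in> S"
    using U m by auto
  ultimately show ?thesis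
    using that by (meson order_trans)
qed

text \<open>By Baire, some set on which \<open>f\<close> is bounded by a constant is dense in a ball
  of \<open>S\<close> around \<open>a\<close>. Differences of its points move the centre to
  \<open>0\<close>, and homogeneity carries the bound to all of \<open>S\<close>.\<close>

lemma almost_preimage:
  fixes f :: "'a::banach \<Rightarrow> 'b::real_normed_vector"
  assumes S: "closed S" "subspace S"
    and add: "\<And>x y. x \<in> S \<Longrightarrow> y \<in> S \<Longrightarrow> f (x + y) = f x + f y"
    and scale: "\<And>c x. x \<in> S \<Longrightarrow> f (c *\<^sub>R x) = c *\<^sub>R f x"
  obtains M where "M \<ge> 0"
    "\<And>x e. x \<in> S \<Longrightarrow> e > 0 \<Longrightarrow> \<exists>y\<in>S. norm (f y) \<le> M * norm x \<and> norm (x - y) < e"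
proof -
  let ?V = "\<lambda>m::nat. {a \<in> S. norm (f a) \<le> real m}"
  have "S \<subseteq> (\<Union>m. ?V m)"
    using real_arch_simple by fastforce
  then obtain m a r where a: "a \<in> S" "r > 0" "ball a r \<inter> S \<subseteq> closure (?V m)"
    using closed_subspace_Baire[of S ?V] S subspace_0 by (metis empty_iff)
  have diff: "f (x - y) = f x - f y" if "x \<in> S" "y \<in> S" for x y
    using add[of x "(-1) *\<^sub>R y"] scale[of y "-1"] that S(2) by (simp add: subspace_neg)
  have small: "\<exists>y\<in>S. norm (f y) \<le> 2 * real m \<and> norm (x - y) < e"
    if x: "x \<in> S" "norm x < r" and e: "e > 0" for x e
  proof -
    have "a \<in> closure (?V m)" "a + x \<in> closure (?V m)"
      using a x S(2) by (auto simp: dist_norm subspace_add)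
    then obtain p q where p: "p \<in> ?V m" "dist p a < e/2" and q: "q \<in> ?V m" "dist q (a + x) < e/2"
      using e by (meson closure_approachable half_gt_zero)
    have "norm (f (q - p)) \<le> 2 * real m"
      using p q diff[of q p] norm_triangle_ineq4[of "f q" "f p"] by simp
    moreover have "norm (x - (q - p)) < e"
      \<comment> \<open>The error is exactly \<open>(p - a) - (q - (a + x))\<close>, a difference of
        two terms shorter than \<open>e/2\<close>.\<close>
      using norm_triangle_ineq4[of "p - a" "q - (a + x)"] p q
      by (simp add: dist_norm algebra_simps)
    ultimately show ?thesis
      using p q S(2) by (intro bexI[of _ "q - p"]) (auto simp: subspace_diff)
  qed
  show ?thesis
  proof (rule that[of "4 * real m / r"])
    show "4 * real m / r \<ge> 0"
      using a(2) by simp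
    fix x and e :: real
    assume x: "x \<in> S" and e: "e > 0"
    show "\<exists>y\<in>S. norm (f y) \<le> 4 * real m / r * norm x \<and> norm (x - y) < e"
    proof (cases "x = 0")
      case True
      then show ?thesis
        using x e scale[of x 0] by (intro bexI[of _ 0]) auto
    next
      case False
      \<comment> \<open>This factor scales \<open>x\<close> to norm \<open>r/2\<close>, inside the
        reach of \<open>small\<close>. The tolerance \<open>c * e\<close> used there becomes
        \<open>e\<close> after dividing by \<open>c\<close>.\<close>
      define c where "c = r / (2 * norm x)"
      have c: "c > 0"
        using False a(2) by (simp add: c_def)
      have "norm (c *\<^sub>R x) < r"
        using False a(2) by (simp add: c_def)
      then obtain z where z: "z \<in> S" "norm (f z) \<le> 2 * real m" "norm (c *\<^sub>R x - z) < c * e"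
        using small[of "c *\<^sub>R x" "c * e"] x c e S(2) by (auto simp: subspace_scale)
      have "norm (f ((1/c) *\<^sub>R z)) \<le> (1/c) * (2 * real m)"
        using z c by (simp add: scale divide_right_mono)
      also have "\<dots> = 4 * real m / r * norm x"
        using False a(2) by (simp add: c_def)
      finally have 1: "norm (f ((1/c) *\<^sub>R z)) \<le> 4 * real m / r * norm x" .
      have "norm (x - (1/c) *\<^sub>R z) = (1/c) * norm (c *\<^sub>R x - z)"
        using c norm_scaleR[of "1/c" "c *\<^sub>R x - z"] by (simp add: scaleR_diff_right)
      also have "\<dots> < e"
        using z c by (simp add: field_simps)
      finally show ?thesis
        using 1 z(1) S(2) by (intro bexI[of _ "(1/c) *\<^sub>R z"]) (auto simp: subspace_scale)
    qed
  qed
qed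

text \<open>Repeated approximate preimages leave remainders \<open>r n\<close> that tend to
  \<open>0\<close>, while the images of the removed pieces form an absolutely convergent series. So
  \<open>f (r n)\<close> converges, its limit is \<open>0\<close> by the hypothesis on the graph,
  and the series gives \<open>f x\<close> together with its bound.\<close>

lemma closed_graph_bounded_on:
  fixes f :: "'a::banach \<Rightarrow> 'a"
  assumes S: "closed S" "subspace S"
    and add: "\<And>x y. x \<in> S \<Longrightarrow> y \<in> S \<Longrightarrow> f (x + y) = f x + f y"
    and scale: "\<And>c x. x \<in> S \<Longrightarrow> f (c *\<^sub>R x) = c *\<^sub>R f x"
    and closed_graph: "\<And>u T. (\<And>k. u k \<in> S) \<Longrightarrow> u \<longlonglongrightarrow> 0 \<Longrightarrow> (\<lambda>k::nat. f (u k)) \<longlonglongrightarrow> T \<Longrightarrow> T = 0"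
  shows "bounded_on S f"
proof -
  obtain M where M: "M \<ge> 0"
    "\<And>x e. x \<in> S \<Longrightarrow> e > 0 \<Longrightarrow> \<exists>y\<in>S. norm (f y) \<le> M * norm x \<and> norm (x - y) < e"
    using almost_preimage[OF S add scale] by blast
  have f0: "f 0 = 0"
    using scale[of 0 0] S(2) by (simp add: subspace_0)
  have diff: "f (x - y) = f x - f y" if "x \<in> S" "y \<in> S" for x y
    using add[of x "(-1) *\<^sub>R y"] scale[of y "-1"] that S(2) by (simp add: subspace_neg)
  have "norm (f x) \<le> 2 * M * norm x" if x: "x \<in> S" for x
  proof (cases "x = 0")
    case False
    let ?b = "\<lambda>n::nat. norm x * (1/2) ^ n"
    have step: "\<exists>r'. (r' \<in> S \<and> norm r' \<le> ?b (Suc n)) \<and> norm (f (r - r')) \<le> M * ?b n"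
      if r: "r \<in> S \<and> norm r \<le> ?b n" for r n
    proof -
      obtain y where y: "y \<in> S" "norm (f y) \<le> M * norm r" "norm (r - y) < ?b (Suc n)"
        using M(2)[of r "?b (Suc n)"] r False by auto
      have "norm (f y) \<le> M * ?b n"
        using y(2) r M(1) by (meson mult_left_mono order_trans)
      then show ?thesis
        using y r S(2) by (intro exI[of _ "r - y"]) (auto simp: subspace_diff)
    qed
    \<comment> \<open>The clause for \<open>n = 0\<close> only pins the start of the recursive
      choice to \<open>x\<close>.\<close>
    have "\<exists>r. \<forall>n. ((r n \<in> S \<and> norm (r n) \<le> ?b n) \<and> (n = 0 \<longrightarrow> r n = x)) \<and>
        norm (f (r n - r (Suc n))) \<le> M * ?b n"
    proof (rule dependent_nat_choice)
      show "\<exists>r. (r \<in> S \<and> norm r \<le> ?b 0) \<and> (0 = (0::nat) \<longrightarrow> r = x)"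
        using x by auto
    next
      fix r and n :: nat
      assume "(r \<in> S \<and> norm r \<le> ?b n) \<and> (n = 0 \<longrightarrow> r = x)"
      then show "\<exists>r'. ((r' \<in> S \<and> norm r' \<le> ?b (Suc n)) \<and> (Suc n = 0 \<longrightarrow> r' = x)) \<and>
          norm (f (r - r')) \<le> M * ?b n"
        using step[of r n] by simp
    qed
    then obtain r where r: "r 0 = x" "\<And>n. r n \<in> S" "\<And>n. norm (r n) \<le> ?b n"
      "\<And>n. norm (f (r n - r (Suc n))) \<le> M * ?b n"
      by blast
    have b: "(\<lambda>n. M * ?b n) sums (2 * M * norm x)"
      using sums_mult[OF geometric_sums[of "1/2::real"], of "M * norm x"] by (simp add: mult_ac)
    have r_lim: "r \<longlonglongrightarrow> 0"
    proof (rule Lim_null_comparison)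
      show "?b \<longlonglongrightarrow> 0"
        by (intro tendsto_mult_right_zero LIMSEQ_power_zero) simp
    qed (simp add: r)
    define w where "w n = f (r n) - f (r (Suc n))" for n
    have w: "norm (w n) \<le> M * ?b n" for n
      using r(4)[of n] by (simp add: w_def diff r)
    have "summable w"
      by (rule summable_comparison_test'[OF sums_summable[OF b]]) (rule w)
    then have "(\<lambda>n. \<Sum>k<n. w k) \<longlonglongrightarrow> suminf w"
      by (rule summable_LIMSEQ)
    moreover have "(\<Sum>k<n. w k) = f x - f (r n)" for n
      by (induction n) (simp_all add: w_def r)
    ultimately have "(\<lambda>n. f x - f (r n)) \<longlonglongrightarrow> suminf w"
      by simp
    \<comment> \<open>The left side is \<open>f (r n)\<close> in disguise, so this is the limit to
      which \<open>closed_graph\<close> applies.\<close>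
    then have "(\<lambda>n. f x - (f x - f (r n))) \<longlonglongrightarrow> f x - suminf w"
      by (intro tendsto_diff tendsto_const)
    then have "f x - suminf w = 0"
      using closed_graph[OF r(2) r_lim, of "f x - suminf w"] by (simp only: diff_diff_eq2) simp
    moreover have "norm (suminf w) \<le> 2 * M * norm x"
      using norm_suminf_le[OF w sums_summable[OF b]] sums_unique[OF b] by simp
    ultimately show ?thesis
      by simp
  qed (simp add: f0)
  then show ?thesis
    by (auto simp: bounded_on_def)
qed

section \<open>Rank one operators\<close>

lemma rank_one_apply [simp]: "blinfun_apply (x \<otimes>\<^sub>1 f) y = blinfun_apply f y *\<^sub>C x"
  by transfer simp

lemma scaleC_blinfun_apply [simp]: "blinfun_apply (c *\<^sub>C T) y = c *\<^sub>C blinfun_apply T y"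
  by transfer simp

lemma rank_one_eq_0_iff: "x \<otimes>\<^sub>1 f = 0 \<longleftrightarrow> x = 0 \<or> f = 0"
proof
  assume "x \<otimes>\<^sub>1 f = 0"
  then have "blinfun_apply f y *\<^sub>C x = 0" for y
    by (metis rank_one_apply zero_blinfun.rep_eq)
  then show "x = 0 \<or> f = 0"
    by (metis blinfun_eqI complex_vector.scale_eq_0_iff zero_blinfun.rep_eq)
qed (auto intro!: blinfun_eqI)

text \<open>Between two rank one operators, \<open>U\<close> survives only as a scalar factor of an
  operator independent of \<open>U\<close>.\<close>

lemma rank_one_compose_rank_one:
  assumes "f \<in> dual_space" "U \<in> bounded_operators"
  shows "(x \<otimes>\<^sub>1 f) o\<^sub>L U o\<^sub>L (y \<otimes>\<^sub>1 g) = blinfun_apply f (blinfun_apply U y) *\<^sub>C (x \<otimes>\<^sub>1 g)"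
proof (rule blinfun_eqI)
  interpret f: Vector_Spaces.linear "(*\<^sub>C)" "(*\<^sub>C)" "blinfun_apply f"
    using assms(1) by (simp add: dual_space_def)
  interpret U: Vector_Spaces.linear "(*\<^sub>C)" "(*\<^sub>C)" "blinfun_apply U"
    using assms(2) by (simp add: bounded_operators_def)
  show "blinfun_apply ((x \<otimes>\<^sub>1 f) o\<^sub>L U o\<^sub>L (y \<otimes>\<^sub>1 g)) z =
    blinfun_apply (blinfun_apply f (blinfun_apply U y) *\<^sub>C (x \<otimes>\<^sub>1 g)) z" for z
    by (simp add: U.scale f.scale scaleC_complex_def scaleC_scaleC mult.commute)
qed

section \<open>Jordan higher derivations\<close>

locale operator_algebra_jordan_higher_derivation =
  fixes \<A> :: "('a::complex_banach \<Rightarrow>\<^sub>L 'a) set"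
    and d :: "nat \<Rightarrow> ('a \<Rightarrow>\<^sub>L 'a) \<Rightarrow> ('a \<Rightarrow>\<^sub>L 'a)"
  assumes algebra: "operator_subalgebra \<A>"
    and closed: "closed \<A>"
    and derivation: "jordan_higher_derivation \<A> d"
begin

lemma csubspace: "csubspace \<A>"
  and bounded_operators: "A \<in> \<A> \<Longrightarrow> A \<in> bounded_operators"
  and compose: "A \<in> \<A> \<Longrightarrow> B \<in> \<A> \<Longrightarrow> A o\<^sub>L B \<in> \<A>"
  using algebra by (auto simp: operator_subalgebra_def)

lemmas add = complex_vector.subspace_add[OF csubspace]
  and scaleC = complex_vector.subspace_scale[OF csubspace]

lemma subspace: "subspace \<A>"
  using csubspace by (simp add: subspace_def complex_vector.subspace_def scaleR_scaleC)

lemma d_mem: "A \<in> \<A> \<Longrightarrow> d n A \<in> \<A>"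
  and d_add: "A \<in> \<A> \<Longrightarrow> B \<in> \<A> \<Longrightarrow> d n (A + B) = d n A + d n B"
  and d_scaleC: "A \<in> \<A> \<Longrightarrow> d n (c *\<^sub>C A) = c *\<^sub>C d n A"
  and d_0: "A \<in> \<A> \<Longrightarrow> d 0 A = A"
  using derivation by (auto simp: jordan_higher_derivation_def linear_mapping_on_def)

lemma d_scaleR: "A \<in> \<A> \<Longrightarrow> d n (c *\<^sub>R A) = c *\<^sub>R d n A"
  by (simp add: scaleR_scaleC d_scaleC)

lemma d_diff: "A \<in> \<A> \<Longrightarrow> B \<in> \<A> \<Longrightarrow> d n (A - B) = d n A - d n B"
  using d_add[of A "(-1) *\<^sub>R B" n] d_scaleR[of B n "-1"] subspace by (simp add: subspace_neg)

lemma d_jordan: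
  assumes "A \<in> \<A>" "B \<in> \<A>"
  shows "d n ((A o\<^sub>L B) + (B o\<^sub>L A)) =
    (\<Sum>i\<le>n. (d i A o\<^sub>L d (n - i) B) + (d i B o\<^sub>L d (n - i) A))"
  using derivation assms unfolding jordan_higher_derivation_def sum_add_eq_conv_atMost by blast

text \<open>Boundedness of the lower terms gives \<open>d i (u k)\<close> the limit \<open>0\<close>
  for \<open>i < n\<close>. Only the summands containing \<open>d n (u k)\<close> survive, and there
  \<open>B\<close> is hit by \<open>d 0\<close>, the identity.\<close>

lemma tendsto_d_jordan:
  assumes bounded: "\<And>i. i < n \<Longrightarrow> bounded_on \<A> (d i)"
    and u: "\<And>k::nat. u k \<in> \<A>" "u \<longlonglongrightarrow> 0" "(\<lambda>k. d n (u k)) \<longlonglongrightarrow> T"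
    and B: "B \<in> \<A>"
  shows "(\<lambda>k. d n ((u k o\<^sub>L B) + (B o\<^sub>L u k))) \<longlonglongrightarrow> (T o\<^sub>L B) + (B o\<^sub>L T)"
proof -
  note compose_lim = bounded_bilinear.tendsto[OF bounded_bilinear_blinfun_compose]
  define L where "L i = (if i = n then T else 0)" for i
  have L: "(\<lambda>k. d i (u k)) \<longlonglongrightarrow> L i" if i: "i \<le> n" for i
  proof (cases "i = n")
    case False
    then obtain K where K: "\<And>A. A \<in> \<A> \<Longrightarrow> norm (d i A) \<le> K * norm A"
      using bounded[of i] i by (auto simp: bounded_on_def)
    have "(\<lambda>k. d i (u k)) \<longlonglongrightarrow> 0"
    proof (rule Lim_null_comparison)
      show "(\<lambda>k. K * norm (u k)) \<longlonglongrightarrow> 0"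
        using u(2) by (intro tendsto_mult_right_zero tendsto_norm_zero)
    qed (simp add: K u)
    then show ?thesis
      using False by (simp add: L_def)
  qed (simp add: L_def u)
  have "(\<lambda>k. d n ((u k o\<^sub>L B) + (B o\<^sub>L u k))) \<longlonglongrightarrow>
      (\<Sum>i\<le>n. (L i o\<^sub>L d (n - i) B) + (d i B o\<^sub>L L (n - i)))"
    unfolding d_jordan[OF u(1) B]
    by (intro tendsto_sum tendsto_add compose_lim tendsto_const L) auto
  \<comment> \<open>The first kind of summand survives at \<open>i = n\<close>, the second at
    \<open>i = 0\<close>.\<close>
  also have "(\<Sum>i\<le>n. (L i o\<^sub>L d (n - i) B) + (d i B o\<^sub>L L (n - i))) =
      (\<Sum>i\<le>n. if i = n then T o\<^sub>L B else 0) + (\<Sum>i\<le>n. if i = 0 then B o\<^sub>L T else 0)"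
    unfolding sum.distrib
    by (intro arg_cong2[where f = "(+)"] sum.cong)
      (auto simp: L_def d_0 B bounded_bilinear.zero_left[OF bounded_bilinear_blinfun_compose]
        bounded_bilinear.zero_right[OF bounded_bilinear_blinfun_compose])
  finally show ?thesis
    by simp
qed

text \<open>\<open>W\<close> expresses the triple product by nested Jordan products, to which
  \<open>tendsto_d_jordan\<close> applies twice: the inner products with \<open>u k\<close> again
  tend to \<open>0\<close> (\<open>lim0\<close>) and have convergent images under
  \<open>d n\<close>.\<close>

lemma tendsto_d_triple:
  assumes bounded: "\<And>i. i < n \<Longrightarrow> bounded_on \<A> (d i)"
    and u: "\<And>k::nat. u k \<in> \<A>" "u \<longlonglongrightarrow> 0" "(\<lambda>k. d n (u k)) \<longlonglongrightarrow> T"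
    and B: "B \<in> \<A>" and C: "C \<in> \<A>"
  shows "(\<lambda>k. d n ((B o\<^sub>L u k o\<^sub>L C) + (C o\<^sub>L u k o\<^sub>L B))) \<longlonglongrightarrow>
    (B o\<^sub>L T o\<^sub>L C) + (C o\<^sub>L T o\<^sub>L B)"
proof -
  note bil = bounded_bilinear_blinfun_compose
  note jordan_lim = tendsto_d_jordan[OF bounded]
  let ?J = "\<lambda>A B :: 'a \<Rightarrow>\<^sub>L 'a. (A o\<^sub>L B) + (B o\<^sub>L A)"
  have mem: "?J A B \<in> \<A>" if "A \<in> \<A>" "B \<in> \<A>" for A B
    using that by (simp add: add compose)
  have lim0: "(\<lambda>k. ?J (u k) D) \<longlonglongrightarrow> 0" for D
    using bounded_bilinear.tendsto[OF bil u(2) tendsto_const[of D]]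
      bounded_bilinear.tendsto[OF bil tendsto_const[of D] u(2)]
    by (auto intro!: tendsto_add_zero simp: bounded_bilinear.zero_left[OF bil]
        bounded_bilinear.zero_right[OF bil])
  define W where "W A = (1/2::real) *\<^sub>R (?J (?J A B) C + ?J (?J A C) B - ?J A (?J B C))" for A
  have W: "W A = (B o\<^sub>L A o\<^sub>L C) + (C o\<^sub>L A o\<^sub>L B)" for A
  proof -
    have "?J (?J A B) C + ?J (?J A C) B - ?J A (?J B C) =
        2 *\<^sub>R ((B o\<^sub>L A o\<^sub>L C) + (C o\<^sub>L A o\<^sub>L B))"
      by (rule blinfun_eqI)
        (simp add: blinfun.add_left blinfun.diff_left blinfun.scaleR_left blinfun.add_right
          scaleR_2 algebra_simps)
    then show ?thesis
      by (simp add: W_def)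
  qed
  have dW: "d n (W A) = (1/2::real) *\<^sub>R (d n (?J (?J A B) C) + d n (?J (?J A C) B)
      - d n (?J A (?J B C)))" if "A \<in> \<A>" for A
    unfolding W_def using that B C subspace
    by (simp add: d_scaleR d_diff d_add mem add compose subspace_diff subspace_add
        del: scaleR_diff_right)
  have "(\<lambda>k. d n (W (u k))) \<longlonglongrightarrow> W T"
    unfolding dW[OF u(1)] unfolding W_def
    by (intro tendsto_scaleR tendsto_const tendsto_add[OF jordan_lim jordan_lim, THEN tendsto_diff]
        jordan_lim mem u lim0 B C; assumption)
  then show ?thesis
    by (simp only: W)
qed

text \<open>Two limits of \<open>d n\<close> at the triple products of \<open>u k\<close> are
  compared. One comes from \<open>tendsto_d_triple\<close>; the other is \<open>0\<close>, since by
  linearity only scalars tending to \<open>0\<close> times fixed operators appear.\<close>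

lemma separating_element_rank_one:
  assumes bounded: "\<And>i. i < n \<Longrightarrow> bounded_on \<A> (d i)"
    and u: "\<And>k::nat. u k \<in> \<A>" "u \<longlonglongrightarrow> 0" "(\<lambda>k. d n (u k)) \<longlonglongrightarrow> T"
    and xf: "(x, f) \<in> rank_one_pairs \<A>" and yg: "(y, g) \<in> rank_one_pairs \<A>"
    and xg: "x \<otimes>\<^sub>1 g \<in> \<A>"
  shows "blinfun_apply f (blinfun_apply T y) *\<^sub>C (x \<otimes>\<^sub>1 g) +
    blinfun_apply g (blinfun_apply T x) *\<^sub>C (y \<otimes>\<^sub>1 f) = 0"
proof -
  let ?B = "x \<otimes>\<^sub>1 f" and ?C = "y \<otimes>\<^sub>1 g"
  have B: "?B \<in> \<A>" "f \<in> dual_space" and C: "?C \<in> \<A>" "g \<in> dual_space"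
    using xf yg by (auto simp: rank_one_pairs_def)
  have T: "T \<in> \<A>"
    using closed_sequentially[OF closed _ u(3)] d_mem u(1) by blast
  \<comment> \<open>If \<open>y \<otimes>\<^sub>1 f \<notin> \<A>\<close>, then \<open>?C A ?B \<in> \<A>\<close> forces its coefficient \<open>g (A x)\<close> to vanish.\<close>
  define E where "E = (if y \<otimes>\<^sub>1 f \<in> \<A> then y \<otimes>\<^sub>1 f else 0)"
  have E: "E \<in> \<A>"
    using csubspace by (simp add: E_def complex_vector.subspace_0)
  have gE: "blinfun_apply g (blinfun_apply A x) *\<^sub>C (y \<otimes>\<^sub>1 f) =
      blinfun_apply g (blinfun_apply A x) *\<^sub>C E" if "A \<in> \<A>" for A
  proof (cases "y \<otimes>\<^sub>1 f \<in> \<A>")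
    case False
    let ?c = "blinfun_apply g (blinfun_apply A x)"
    have "?c *\<^sub>C (y \<otimes>\<^sub>1 f) \<in> \<A>"
      using compose[OF compose[OF C(1) that] B(1)] rank_one_compose_rank_one C(2) that
        bounded_operators by metis
    then have "inverse ?c *\<^sub>C ?c *\<^sub>C (y \<otimes>\<^sub>1 f) \<in> \<A>"
      by (rule scaleC)
    then have "?c = 0"
      using False by (cases "?c = 0") (auto simp: scaleC_scaleC scaleC_one)
    then show ?thesis
      by simp
  qed (simp add: E_def)
  have triple: "(?B o\<^sub>L A o\<^sub>L ?C) + (?C o\<^sub>L A o\<^sub>L ?B) =
      blinfun_apply f (blinfun_apply A y) *\<^sub>C (x \<otimes>\<^sub>1 g) +
      blinfun_apply g (blinfun_apply A x) *\<^sub>C E" if "A \<in> \<A>" for A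
    using that B C by (simp add: rank_one_compose_rank_one bounded_operators gE)
  have scalar: "(\<lambda>k. blinfun_apply h (blinfun_apply (u k) z) *\<^sub>C D) \<longlonglongrightarrow> 0"
    for h :: "'a \<Rightarrow>\<^sub>L complex" and z and D :: "'a \<Rightarrow>\<^sub>L 'a"
  proof -
    have "(\<lambda>k. blinfun_apply h (blinfun_apply (u k) z)) \<longlonglongrightarrow> blinfun_apply h (blinfun_apply 0 z)"
      by (intro blinfun.tendsto tendsto_const u)
    then show ?thesis
      using bounded_linear.tendsto[OF bounded_linear_scaleC_left] by fastforce
  qed
  have "(\<lambda>k. d n ((?B o\<^sub>L u k o\<^sub>L ?C) + (?C o\<^sub>L u k o\<^sub>L ?B))) \<longlonglongrightarrow> 0"
    unfolding triple[OF u(1)]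
    by (simp add: d_add d_scaleC scaleC xg E tendsto_add_zero scalar)
  from LIMSEQ_unique[OF tendsto_d_triple[OF bounded u B(1) C(1)] this] show ?thesis
    by (simp add: triple T gE)
qed

text \<open>A nonzero coefficient would put \<open>x \<otimes>\<^sub>1 g\<close> into the algebra.
  The diagonal case then removes the second term of \<open>separating_element_rank_one\<close>, so
  the first vanishes too, a contradiction.\<close>

lemma separating_element_rank_one_eq_0:
  assumes bounded: "\<And>i. i < n \<Longrightarrow> bounded_on \<A> (d i)"
    and u: "\<And>k::nat. u k \<in> \<A>" "u \<longlonglongrightarrow> 0" "(\<lambda>k. d n (u k)) \<longlonglongrightarrow> T"
    and xf: "(x, f) \<in> rank_one_pairs \<A>" and yg: "(y, g) \<in> rank_one_pairs \<A>"
  shows "blinfun_apply f (blinfun_apply T y) = 0"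
proof (rule ccontr)
  note rank_one = separating_element_rank_one[OF bounded u]
  \<comment> \<open>Pairing a rank one operator with itself makes the two terms equal, whence the
    factor \<open>2\<close>.\<close>
  have diag: "blinfun_apply h (blinfun_apply T z) = 0" if "(z, h) \<in> rank_one_pairs \<A>" for z h
  proof -
    have z: "z \<otimes>\<^sub>1 h \<in> \<A>" "z \<noteq> 0" "h \<noteq> 0"
      using that by (auto simp: rank_one_pairs_def)
    have "(2 * blinfun_apply h (blinfun_apply T z)) *\<^sub>C (z \<otimes>\<^sub>1 h) = 0"
      using rank_one[OF _ that that z(1)] by (simp flip: scaleC_add_left)
    then show ?thesis
      using z by (simp add: rank_one_eq_0_iff)
  qed
  let ?c = "blinfun_apply f (blinfun_apply T y)"
  assume c: "?c \<noteq> 0"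
  have T: "T \<in> \<A>"
    using closed_sequentially[OF closed _ u(3)] d_mem u(1) by blast
  have "?c *\<^sub>C (x \<otimes>\<^sub>1 g) \<in> \<A>"
    using compose[OF compose[OF _ T], of "x \<otimes>\<^sub>1 f" "y \<otimes>\<^sub>1 g"] xf yg
    by (simp add: rank_one_pairs_def rank_one_compose_rank_one bounded_operators T)
  then have "inverse ?c *\<^sub>C ?c *\<^sub>C (x \<otimes>\<^sub>1 g) \<in> \<A>"
    by (rule scaleC)
  then have xg: "x \<otimes>\<^sub>1 g \<in> \<A>"
    using c by (simp add: scaleC_scaleC scaleC_one)
  then have "(x, g) \<in> rank_one_pairs \<A>"
    using xf yg by (simp add: rank_one_pairs_def)
  then have "blinfun_apply g (blinfun_apply T x) = 0"
    by (rule diag)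
  then have "?c *\<^sub>C (x \<otimes>\<^sub>1 g) = 0"
    using rank_one[OF _ xf yg xg] by simp
  then show False
    using c xf yg by (simp add: rank_one_eq_0_iff rank_one_pairs_def)
qed

end

theorem theorem3p10:
  fixes \<A> :: "('a::complex_banach \<Rightarrow>\<^sub>L 'a) set"
    and d :: "nat \<Rightarrow> ('a \<Rightarrow>\<^sub>L 'a) \<Rightarrow> ('a \<Rightarrow>\<^sub>L 'a)"
  assumes "operator_subalgebra \<A>"
    and "closed \<A>"
    and "closure (cspan {x. \<exists>f. (x, f) \<in> rank_one_pairs \<A>}) = UNIV"
    and "(\<Inter>f \<in> {f. \<exists>x. (x, f) \<in> rank_one_pairs \<A>}. {y. blinfun_apply f y = 0}) = {0}"
    and "jordan_higher_derivation \<A> d"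
  shows "bounded_sequence_on \<A> d"
proof -
  interpret operator_algebra_jordan_higher_derivation \<A> d
    using assms by unfold_locales
  let ?X = "{x. \<exists>f. (x, f) \<in> rank_one_pairs \<A>}"
  have "bounded_on \<A> (d n)" for n
  \<comment> \<open>The case \<open>n = 0\<close> is the same argument with no lower order
    terms.\<close>
  proof (induction n rule: less_induct)
    case (less n)
    show ?case
    proof (rule closed_graph_bounded_on[OF assms(2) subspace d_add d_scaleR])
      fix u T
      assume u: "\<And>k::nat. u k \<in> \<A>" "u \<longlonglongrightarrow> 0" "(\<lambda>k. d n (u k)) \<longlonglongrightarrow> T"
      \<comment> \<open>Membership in the algebra makes \<open>T\<close> complex-linear, so that its
        kernel, once it contains \<open>?X\<close>, contains \<open>cspan ?X\<close>.\<close>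
      have "T \<in> \<A>"
        using closed_sequentially[OF closed _ u(3)] d_mem u(1) by blast
      then interpret T: Vector_Spaces.linear "(*\<^sub>C)" "(*\<^sub>C)" "blinfun_apply T"
        using bounded_operators by (simp add: bounded_operators_def)
      have "blinfun_apply T y = 0" if "y \<in> ?X" for y
      proof -
        have "blinfun_apply f (blinfun_apply T y) = 0" if "(x, f) \<in> rank_one_pairs \<A>" for x f
          using separating_element_rank_one_eq_0[OF less.IH u that] \<open>y \<in> ?X\<close> by blast
        then show ?thesis
          using assms(4) by blast
      qed
      then have "blinfun_apply T y = 0" if "y \<in> cspan ?X" for y
        using T.eq_0_on_span that unfolding cspan_def by blast
      then have "cspan ?X \<subseteq> {y. blinfun_apply T y = 0}"
        by blast
      moreover have "closed {y. blinfun_apply T y = 0}"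
        by (intro closed_Collect_eq continuous_intros)
      ultimately have "closure (cspan ?X) \<subseteq> {y. blinfun_apply T y = 0}"
        by (rule closure_minimal)
      then show "T = 0"
        using assms(3) by (intro blinfun_eqI) auto
    qed
  qed
  then show ?thesis
    by (simp add: bounded_sequence_on_def)
qed

end
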